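(* For a real number $d>0$ let $\mathcal{I}_d=\{\, i(G) : G \text{ is a graph with } d(G)\le d\,\}\subseteq\mathbb{N}$, where $d(G)$ is the average degree of $G$. There exists a fixed constant $D>0$ such that the following holds: \begin{enumerate} \item If $d\in(0,2)$, then there exist constants $0<c_1(d)\le c_2(d)<1$ such that $$N^{c_1(d)}\;\ll\;|\mathcal{I}_d\cap\{1,\ldots,N\}|\;\ll\;N^{c_2(d)}.$$ \item If $d\ge D$, then every positive integer appears in $\mathcal{I}_d$. \end{enumerate}
   Context: Graphs are finite and simple, and are not required to be connected. An independent set of a graph is a set of vertices no two of which are adjacent (the empty set counts as independent). For a graph $G$, $i(G)$ denotes the number of independent sets of $G$. The average degree of a nonempty graph $G=(V,E)$ is $d(G)=2|E|/|V|$; for the empty graph (no vertices), $d(G)=0$ by convention. $\mathbb{N}=\{1,2,3,\ldots\}$. Notation: $f(N)\ll g(N)$ means there is a constant $C>0$ such that $f(N)\le C g(N)$ for all sufficiently large $N$ (here the constant may depend on $d$). *)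

theory Defs
  imports Complex_Main "HOL-Library.Landau_Symbols" "Graph_Theory.Pair_Digraph"
begin

text \<open>
  A finite simple graph is a \<^locale>\<open>pair_graph\<close>: a finite vertex set with a symmetric, loop-free
  arc relation.  An undirected edge \<open>{u, v}\<close> is represented there by the two arcs \<open>(u, v)\<close> and
  \<open>(v, u)\<close>, so the edge set is recovered by forgetting orientations.
\<close>

definition edges :: "'a pair_pre_digraph \<Rightarrow> 'a set set" where
  "edges G = (\<lambda>(u, v). {u, v}) ` parcs G"

definition average_degree :: "'a pair_pre_digraph \<Rightarrow> real" where
  "average_degree G =
     (if pverts G = {} then 0 else 2 * real (card (edges G)) / real (card (pverts G)))"

definition independent_set :: "'a pair_pre_digraph \<Rightarrow> 'a set \<Rightarrow> bool" where
  "independent_set G S \<longleftrightarrow> S \<subseteq> pverts G \<and> (\<forall>u\<in>S. \<forall>v\<in>S. {u, v} \<notin> edges G)"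

definition num_independent_sets :: "'a pair_pre_digraph \<Rightarrow> nat" where
  "num_independent_sets G = card {S. independent_set G S}"

text \<open>
  Natural numbers serve as vertex names; the lemma \<open>num_independent_sets_in_counts\<close> below shows that
  graphs over other vertex types contribute nothing new.
\<close>

definition independent_set_counts :: "real \<Rightarrow> nat set" where
  "independent_set_counts d =
     {num_independent_sets G | G :: nat pair_pre_digraph. pair_graph G \<and> average_degree G \<le> d}"

lemma num_independent_sets_in_counts:
  fixes G :: "'a pair_pre_digraph"
  assumes "pair_graph G" and "average_degree G \<le> d"
  shows "num_independent_sets G \<in> independent_set_counts d"
proof -
  interpret pair_graph G by fact
  obtain f :: "'a \<Rightarrow> nat" where inj: "inj_on f (pverts G)"
    using finite_imp_inj_to_nat_seg[OF pair_finite_verts] by blast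
  define H where "H = \<lparr>pverts = f ` pverts G, parcs = map_prod f f ` parcs G\<rparr>"
  have wf: "u \<in> pverts G \<and> v \<in> pverts G" if "(u, v) \<in> parcs G" for u v
    using that wellformed by fastforce
  have symG: "(v, u) \<in> parcs G" if "(u, v) \<in> parcs G" for u v
    using that arcs_symmetric by simp
  have "pair_graph H"
  proof unfold_locales
    show "fst e \<in> pverts H" "snd e \<in> pverts H" if "e \<in> parcs H" for e
      using that wf by (auto simp: H_def)
    show "finite (pverts H)" "finite (parcs H)"
      using pair_finite_verts pair_finite_arcs by (auto simp: H_def)
    show "fst e \<noteq> snd e" if "e \<in> parcs H" for e
      using that wf no_loops inj_onD[OF inj] by (fastforce simp: H_def)
    show "symmetric H"
      using symG unfolding symmetric_def H_def by (auto intro!: symI simp: arcs_ends_def arc_to_ends_def)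
  qed
  have edgesH: "edges H = (`) f ` edges G"
    by (simp add: edges_def H_def image_image case_prod_unfold)
  have sub: "edges G \<subseteq> Pow (pverts G)"
    using wf by (auto simp: edges_def)
  have injP: "inj_on ((`) f) (Pow (pverts G))"
    using inj by (rule inj_on_image_Pow)
  have "card (edges H) = card (edges G)"
    unfolding edgesH by (rule card_image[OF inj_on_subset[OF injP sub]])
  moreover have "card (pverts H) = card (pverts G)"
    using inj by (simp add: H_def card_image)
  moreover have "pverts H = {} \<longleftrightarrow> pverts G = {}"
    by (simp add: H_def)
  ultimately have "average_degree H = average_degree G"
    by (simp add: average_degree_def)
  have mem: "{f u, f v} \<in> edges H \<longleftrightarrow> {u, v} \<in> edges G"
    if "u \<in> pverts G" "v \<in> pverts G" for u v
    using inj_on_image_mem_iff[OF injP _ sub, of "{u, v}"] that by (simp add: edgesH)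
  have "{S. independent_set H S} = (`) f ` {S. independent_set G S}"
  proof (intro set_eqI iffI)
    fix T assume "T \<in> {S. independent_set H S}"
    then have T: "T \<subseteq> f ` pverts G" "\<forall>u\<in>T. \<forall>v\<in>T. {u, v} \<notin> edges H"
      by (auto simp: independent_set_def H_def)
    then obtain S where S: "S \<subseteq> pverts G" "T = f ` S"
      by (auto simp: subset_image_iff)
    have "{u, v} \<notin> edges G" if "u \<in> S" "v \<in> S" for u v
      using mem[of u v] T(2) S that by blast
    with S(1) have "independent_set G S"
      by (simp add: independent_set_def)
    with S(2) show "T \<in> (`) f ` {S. independent_set G S}"
      by blast
  next
    fix T assume "T \<in> (`) f ` {S. independent_set G S}"
    then obtain S where S: "S \<subseteq> pverts G" "\<forall>u\<in>S. \<forall>v\<in>S. {u, v} \<notin> edges G" "T = f ` S"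
      by (auto simp: independent_set_def)
    then have "{f u, f v} \<notin> edges H" if "u \<in> S" "v \<in> S" for u v
      using mem that by blast
    with S show "T \<in> {S. independent_set H S}"
      by (auto simp: independent_set_def H_def)
  qed
  moreover have "{S. independent_set G S} \<subseteq> Pow (pverts G)"
    by (auto simp: independent_set_def)
  ultimately have "num_independent_sets H = num_independent_sets G"
    unfolding num_independent_sets_def using card_image inj_on_subset[OF injP] by metis
  with \<open>pair_graph H\<close> \<open>average_degree H = average_degree G\<close> assms(2) show ?thesis
    unfolding independent_set_counts_def by (metis (mono_tags, lifting) mem_Collect_eq)
qed

end

theory Submission
  imports Defs "HOL-Real_Asymp.Real_Asymp"
begin

text \<open>
  Write \<open>i(G)\<close> for the number of independent sets.

  \<^emph>\<open>Every positive integer occurs at bounded average degree.\<close>  Keep track of a graph \<open>G\<close> with a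
  marked vertex set \<open>S\<close> through the pair \<open>(\<alpha>, \<beta>) = (i(G - S), i(G))\<close>.  Put a graph \<open>K\<close> with
  \<open>i(K) = q\<close> next to \<open>G\<close>, add a new vertex \<open>h\<close> adjacent to all of \<open>S\<close> and all of \<open>K\<close>, and mark
  \<open>{h} \<union> K\<close> instead of \<open>S\<close>.  The independent sets containing \<open>h\<close> number \<open>\<alpha>\<close>, the others \<open>q \<beta>\<close>, so
  the pair becomes \<open>(\<beta>, \<alpha> + q \<beta>)\<close>: one step of the Euclidean algorithm run backwards
  (\<open>euclid_step\<close>).  Hence any pair \<open>\<alpha> \<le> \<beta>\<close> is reached once the quotients of \<open>\<beta>/\<alpha>\<close> and the greatest
  common divisor are realised, and since the product of these numbers is at most \<open>\<beta>\<close>, the cost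
  is logarithmic in \<open>\<beta>\<close> if each of them costs a logarithm (\<open>sparsely_realised_pair\<close>).  Each \<open>K\<close> is
  joined to at most two of the vertices \<open>h\<close>, so one level of this recursion adds up to \<open>2|K|\<close> edges;
  left alone, this would spoil the constant.  A cheap first step prevents it: write
  \<open>n = \<alpha> + 2\<^sup>k \<beta>\<close> with \<open>2\<^sup>k\<close> close to \<open>\<surd>n\<close> and realise the quotient \<open>2\<^sup>k\<close> by \<open>k\<close> isolated vertices.
  Only \<open>\<beta>\<close>, about half as long as \<open>n\<close> in binary, is passed to the recursion, which now contracts.  The
  result is a graph with \<open>i(G) = n\<close> and \<open>O(log n)\<close> vertices and edges
  (\<open>every_positive_sparsely_realised\<close>).  As \<open>n \<le> 2\<^bsup>|V|\<^esup>\<close>, its average degree is bounded.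

  \<^emph>\<open>Lower bound.\<close>  Adding a multiple of \<open>log n\<close> isolated vertices makes the average degree as
  small as desired and only multiplies \<open>i(G)\<close> by a power of two that is polynomial in \<open>n\<close>; using the
  same power for all \<open>n\<close> in an initial segment keeps the values distinct (\<open>counts_lower_bound\<close>).

  \<^emph>\<open>Upper bound.\<close>  If \<open>d < 2\<close>, a graph on \<open>v\<close> vertices has at least \<open>(1 - d/2) v\<close> components, and a
  positive proportion of \<open>v\<close> of them have bounded size.  So \<open>i(G) = A B\<close>, where \<open>A\<close> is a product of
  integers from a fixed finite set and, for some \<open>\<delta> > 0\<close> depending on \<open>d\<close>,
  \<open>A \<ge> 2\<^bsup>\<delta>v\<^esup> \<ge> i(G)\<^bsup>\<delta>\<^esup>\<close> (\<open>count_has_large_smooth_factor\<close>).  There are polylogarithmically many such \<open>A \<le> N\<close>, and \<open>B \<le> N\<^bsup>1-\<delta>\<^esup>\<close> (\<open>counts_upper_bound\<close>).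
\<close>

section \<open>Independent sets of a set system\<close>

text \<open>
  Independence is expressed by not containing an edge.  Thus \<open>indep V' E\<close> for \<open>V' \<subseteq> V\<close> already
  describes the induced subgraph, and deleting vertices never changes the edge set.
\<close>

definition indep :: "'a set \<Rightarrow> 'a set set \<Rightarrow> 'a set set" where
  "indep V E = {S. S \<subseteq> V \<and> (\<forall>e\<in>E. \<not> e \<subseteq> S)}"

definition graph_on :: "'a set \<Rightarrow> 'a set set \<Rightarrow> bool" where
  "graph_on V E \<longleftrightarrow> finite V \<and> (\<forall>e\<in>E. e \<subseteq> V \<and> card e = 2)"

lemma graph_onD:
  assumes "graph_on V E"
  shows "finite V" "finite E" "\<And>e. e \<in> E \<Longrightarrow> e \<subseteq> V" "\<And>e. e \<in> E \<Longrightarrow> card e = 2"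
    "\<And>e. e \<in> E \<Longrightarrow> e \<noteq> {}"
proof -
  show 1: "finite V" "\<And>e. e \<in> E \<Longrightarrow> e \<subseteq> V" "\<And>e. e \<in> E \<Longrightarrow> card e = 2"
    using assms by (auto simp: graph_on_def)
  then show "\<And>e. e \<in> E \<Longrightarrow> e \<noteq> {}" by force
  have "E \<subseteq> Pow V" using 1 by auto
  then show "finite E" using 1(1) by (meson finite_Pow_iff finite_subset)
qed

lemma finite_indep: "finite V \<Longrightarrow> finite (indep V E)"
  by (rule finite_subset[of _ "Pow V"]) (auto simp: indep_def)

lemma indep_cong:
  assumes "\<And>e. e \<subseteq> V \<Longrightarrow> e \<in> E \<longleftrightarrow> e \<in> F"
  shows "indep V E = indep V F"
  unfolding indep_def using assms by blast

lemma indep_no_edges: "indep V {} = Pow V"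
  by (auto simp: indep_def)

lemma card_indep_le: "finite V \<Longrightarrow> card (indep V E) \<le> 2 ^ card V"
  using card_mono[of "Pow V" "indep V E"] by (auto simp: indep_def card_Pow)

lemma card_indep_disjoint:
  assumes "V \<inter> W = {}" and split: "\<And>e. e \<in> E \<Longrightarrow> e \<subseteq> V \<union> W \<Longrightarrow> e \<subseteq> V \<or> e \<subseteq> W"
  shows "card (indep (V \<union> W) E) = card (indep V E) * card (indep W E)"
proof -
  have "bij_betw (\<lambda>(S, T). S \<union> T) (indep V E \<times> indep W E) (indep (V \<union> W) E)"
  proof (rule bij_betw_byWitness[where f' = "\<lambda>S. (S \<inter> V, S \<inter> W)"])
    show "(\<lambda>(S, T). S \<union> T) ` (indep V E \<times> indep W E) \<subseteq> indep (V \<union> W) E"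
    proof clarsimp
      fix S T assume ST: "S \<in> indep V E" "T \<in> indep W E"
      have False if e: "e \<in> E" "e \<subseteq> S \<union> T" for e
      proof -
        have "e \<subseteq> V \<or> e \<subseteq> W" using split[of e] e ST by (auto simp: indep_def)
        moreover have "S \<subseteq> V" "T \<subseteq> W" using ST by (auto simp: indep_def)
        ultimately have "e \<subseteq> S \<or> e \<subseteq> T" using e(2) assms(1) by blast
        then show False using ST e(1) by (auto simp: indep_def)
      qed
      then show "S \<union> T \<in> indep (V \<union> W) E" using ST by (auto simp: indep_def)
    qed
  qed (use assms(1) in \<open>auto simp: indep_def\<close>)
  then show ?thesis by (metis bij_betw_same_card card_cartesian_product)
qed

lemma card_indep_union:
  assumes "graph_on V E" "graph_on W F" "V \<inter> W = {}"
  shows "card (indep (V \<union> W) (E \<union> F)) = card (indep V E) * card (indep W F)"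
proof -
  have E: "e \<subseteq> V" "e \<noteq> {}" if "e \<in> E" for e using graph_onD(3,5)[OF assms(1) that] .
  have F: "e \<subseteq> W" "e \<noteq> {}" if "e \<in> F" for e using graph_onD(3,5)[OF assms(2) that] .
  have "e \<notin> F" if "e \<subseteq> V" for e using F[of e] that assms(3) by blast
  then have V: "indep V (E \<union> F) = indep V E" by (intro indep_cong) simp
  have "e \<notin> E" if "e \<subseteq> W" for e using E[of e] that assms(3) by blast
  then have W: "indep W (E \<union> F) = indep W F" by (intro indep_cong) simp
  have "card (indep (V \<union> W) (E \<union> F)) = card (indep V (E \<union> F)) * card (indep W (E \<union> F))"
    using assms(3) E(1) F(1) by (intro card_indep_disjoint) auto
  then show ?thesis unfolding V W .
qed

lemma graph_on_union:
  "graph_on V E \<Longrightarrow> graph_on W F \<Longrightarrow> graph_on (V \<union> W) (E \<union> F)"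
  by (auto simp: graph_on_def)

lemma graph_on_fresh_copy:
  fixes V X :: "nat set"
  assumes "graph_on V E" "finite X"
  obtains V' E' where "graph_on V' E'" "V' \<inter> X = {}" "card V' = card V" "card E' = card E"
    "card (indep V' E') = card (indep V E)"
proof -
  note D = graph_onD[OF assms(1)]
  define f where "f = (+) (Suc (Max (insert 0 X)))"
  have inj: "inj f" by (auto simp: f_def inj_def)
  have inj2: "inj ((`) f)" using inj by (auto simp: inj_def inj_image_eq_iff)
  have fresh: "f ` V \<inter> X = {}"
  proof -
    have "x \<le> Max (insert 0 X)" if "x \<in> X" for x using that assms(2) by simp
    then show ?thesis by (force simp: f_def)
  qed
  have "graph_on (f ` V) ((`) f ` E)"
    using D inj by (auto simp: graph_on_def card_image inj_on_subset)
  moreover have "indep (f ` V) ((`) f ` E) = (`) f ` indep V E"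
  proof (intro equalityI subsetI)
    fix T assume T: "T \<in> indep (f ` V) ((`) f ` E)"
    then obtain S where S: "S \<subseteq> V" "T = f ` S" by (auto simp: indep_def subset_image_iff)
    then have "S \<in> indep V E" using T by (auto simp: indep_def inj_image_subset_iff[OF inj])
    then show "T \<in> (`) f ` indep V E" using S by blast
  qed (auto simp: indep_def inj_image_subset_iff[OF inj])
  moreover have "card ((`) f ` indep V E) = card (indep V E)" "card ((`) f ` E) = card E"
    using inj2 by (meson card_image inj_on_subset subset_UNIV)+
  moreover have "card (f ` V) = card V" using inj by (meson card_image inj_on_subset subset_UNIV)
  ultimately show ?thesis using that fresh by metis
qed

text \<open>
  The hypothesis on the degree is multiplied out, which also covers the graph without vertices.
\<close>

lemma card_indep_in_counts:
  fixes V :: "'a set"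
  assumes "graph_on V E" and d: "0 \<le> d" "2 * real (card E) \<le> d * real (card V)"
  shows "card (indep V E) \<in> independent_set_counts d"
proof -
  note D = graph_onD[OF assms(1)]
  define G where "G = \<lparr>pverts = V, parcs = {(u, v). {u, v} \<in> E}\<rparr>"
  have ne: "u \<noteq> v" if "{u, v} \<in> E" for u v using D(4)[OF that] by auto
  have in_V: "u \<in> V \<and> v \<in> V" if "{u, v} \<in> E" for u v using D(3)[OF that] by auto
  have "pair_graph G"
  proof unfold_locales
    show "fst a \<in> pverts G" "snd a \<in> pverts G" if "a \<in> parcs G" for a
      using that in_V by (auto simp: G_def)
    show "finite (pverts G)" using D by (simp add: G_def)
    have "parcs G \<subseteq> V \<times> V" using in_V by (auto simp: G_def)
    then show "finite (parcs G)" using D(1) by (meson finite_SigmaI finite_subset)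
    show "fst a \<noteq> snd a" if "a \<in> parcs G" for a using that ne by (auto simp: G_def)
    show "symmetric G"
      by (auto simp: symmetric_def G_def arcs_ends_def arc_to_ends_def insert_commute intro!: symI)
  qed
  moreover have edges: "edges G = E"
  proof -
    have "e \<in> edges G" if "e \<in> E" for e
    proof -
      have "card e = 2" using D(4) that by blast
      then obtain x y where "e = {x, y}" by (auto simp: card_2_iff)
      then show ?thesis using that by (force simp: edges_def G_def)
    qed
    then show ?thesis by (auto simp: edges_def G_def)
  qed
  moreover have "independent_set G S \<longleftrightarrow> S \<in> indep V E" for S
  proof -
    have "(\<forall>u\<in>S. \<forall>v\<in>S. {u, v} \<notin> E) \<longleftrightarrow> (\<forall>e\<in>E. \<not> e \<subseteq> S)"
      using D(4) by (force simp: card_2_iff)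
    then show ?thesis unfolding independent_set_def edges by (simp add: G_def indep_def)
  qed
  then have "num_independent_sets G = card (indep V E)"
    by (simp add: num_independent_sets_def)
  moreover have "average_degree G \<le> d"
    unfolding average_degree_def edges using d D(1)
    by (auto simp: G_def field_simps card_gt_0_iff)
  ultimately show ?thesis using num_independent_sets_in_counts by metis
qed

lemma graph_on_of_pair_graph:
  assumes "pair_graph G"
  shows "graph_on (pverts G) (edges G)"
    "num_independent_sets G = card (indep (pverts G) (edges G))"
proof -
  interpret pair_graph G by fact
  show g: "graph_on (pverts G) (edges G)"
    unfolding graph_on_def edges_def using wellformed no_loops pair_finite_verts
    by (force simp: card_2_iff)
  note D = graph_onD[OF g]
  have "independent_set G S \<longleftrightarrow> S \<in> indep (pverts G) (edges G)" for S
  proof -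
    have "(\<forall>u\<in>S. \<forall>v\<in>S. {u, v} \<notin> edges G) \<longleftrightarrow> (\<forall>e\<in>edges G. \<not> e \<subseteq> S)"
      using D(4) by (force simp: card_2_iff)
    then show ?thesis unfolding independent_set_def by (simp add: indep_def)
  qed
  then show "num_independent_sets G = card (indep (pverts G) (edges G))"
    by (simp add: num_independent_sets_def)
qed

section \<open>Every number is realised by a sparse graph of logarithmic size\<close>

text \<open>
  The edge bound counts \<open>W\<close> once for the new vertex; \<open>W\<close> is counted again at the next step, as part
  of the new marked set \<open>insert h W\<close>.
\<close>

lemma euclid_step:
  fixes V W :: "'a set"
  assumes G: "graph_on V E" and K: "graph_on W F" and disj: "V \<inter> W = {}"
    and S: "S \<subseteq> V" and h: "h \<notin> V \<union> W"
  defines "V' \<equiv> insert h (V \<union> W)" and "E' \<equiv> E \<union> F \<union> (\<lambda>x. {h, x}) ` (S \<union> W)"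
  shows "graph_on V' E'"
    "card (indep (V' - insert h W) E') = card (indep V E)"
    "card (indep V' E') = card (indep (V - S) E) + card (indep W F) * card (indep V E)"
    "card V' = card V + card W + 1"
    "card E' \<le> card E + card F + card S + card W"
proof -
  note D = graph_onD[OF G] graph_onD[OF K]
  have finS: "finite S" using S D(1) finite_subset by blast
  have E: "e \<subseteq> V" "e \<noteq> {}" if "e \<in> E" for e using D that by auto
  have F: "e \<subseteq> W" "e \<noteq> {}" if "e \<in> F" for e using D that by auto
  show "graph_on V' E'"
  proof -
    have "card {h, x} = 2 \<and> {h, x} \<subseteq> V'" if "x \<in> S \<union> W" for x
      using that S h by (cases "x = h") (auto simp: V'_def)
    then show ?thesis using G K unfolding graph_on_def E'_def V'_def by blast
  qed
  show "card V' = card V + card W + 1"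
    using D(1,6) h disj by (simp add: V'_def card_Un_disjoint)
  have "card E' \<le> card E + card F + card ((\<lambda>x. {h, x}) ` (S \<union> W))"
    unfolding E'_def
    using card_Un_le[of "E \<union> F" "(\<lambda>x. {h, x}) ` (S \<union> W)"] card_Un_le[of E F] by linarith
  also have "card ((\<lambda>x. {h, x}) ` (S \<union> W)) \<le> card S + card W"
    using card_image_le[of "S \<union> W"] card_Un_le[of S W] finS D(6)
    by (intro order.trans[OF card_image_le]) auto
  finally show "card E' \<le> card E + card F + card S + card W" by simp
  have "V' - insert h W = V" using h disj by (auto simp: V'_def)
  moreover have "indep V E' = indep V E"
  proof (rule indep_cong)
    fix e assume "e \<subseteq> V"
    then have "e \<notin> F" using F[of e] disj by blast
    then show "e \<in> E' \<longleftrightarrow> e \<in> E" using \<open>e \<subseteq> V\<close> h by (auto simp: E'_def)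
  qed
  ultimately show "card (indep (V' - insert h W) E') = card (indep V E)" by simp
  \<comment> \<open>An independent set containing \<open>h\<close> misses \<open>S\<close> and \<open>W\<close>; one that omits \<open>h\<close> is unaffected by it.\<close>
  have split: "indep V' E' = insert h ` indep (V - S) E \<union> indep (V \<union> W) (E \<union> F)"
  proof (intro equalityI subsetI)
    fix T assume T: "T \<in> indep V' E'"
    have TE: "\<not> e \<subseteq> T" if "e \<in> E'" for e using T that by (auto simp: indep_def)
    show "T \<in> insert h ` indep (V - S) E \<union> indep (V \<union> W) (E \<union> F)"
    proof (cases "h \<in> T")
      case True
      have "x \<notin> T" if "x \<in> S \<union> W" for x
        using TE[of "{h, x}"] that True by (auto simp: E'_def)
      then have "T - {h} \<in> indep (V - S) E"
        using T TE by (auto simp: indep_def V'_def E'_def)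
      then show ?thesis using True by (metis UnI1 image_eqI insert_Diff)
    next
      case False
      then show ?thesis using T by (auto simp: indep_def V'_def E'_def)
    qed
  next
    fix T assume "T \<in> insert h ` indep (V - S) E \<union> indep (V \<union> W) (E \<union> F)"
    then show "T \<in> indep V' E'"
    proof
      assume "T \<in> insert h ` indep (V - S) E"
      then obtain U where U: "U \<in> indep (V - S) E" "T = insert h U" by blast
      have UV: "U \<subseteq> V - S" "\<And>e. e \<in> E \<Longrightarrow> \<not> e \<subseteq> U" using U(1) by (auto simp: indep_def)
      have "\<not> e \<subseteq> T" if e: "e \<in> E'" for e
      proof
        assume eT: "e \<subseteq> T"
        consider "e \<in> E" | "e \<in> F" | x where "e = {h, x}" "x \<in> S \<union> W"
          using e by (auto simp: E'_def)
        then show False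
        proof cases
          case 1
          then have "e \<subseteq> U" using eT E(1) h U(2) by blast
          then show False using UV 1 by blast
        next
          case 2
          then show False using F[OF 2] eT UV(1) U(2) h disj by blast
        next
          case 3
          then show False using eT UV(1) U(2) h S disj by blast
        qed
      qed
      then show ?thesis using UV(1) U(2) by (auto simp: indep_def V'_def)
    next
      assume T: "T \<in> indep (V \<union> W) (E \<union> F)"
      then have "h \<notin> T" using h by (auto simp: indep_def)
      then show ?thesis using T by (auto simp: indep_def V'_def E'_def)
    qed
  qed
  have "inj_on (insert h) (indep (V - S) E)"
    using h by (intro inj_on_inverseI[where g = "\<lambda>T. T - {h}"]) (auto simp: indep_def)
  then have "card (insert h ` indep (V - S) E) = card (indep (V - S) E)" by (rule card_image)
  moreover have "insert h ` indep (V - S) E \<inter> indep (V \<union> W) (E \<union> F) = {}"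
    using h by (auto simp: indep_def)
  ultimately show "card (indep V' E') = card (indep (V - S) E) + card (indep W F) * card (indep V E)"
    unfolding split using card_indep_union[OF G K disj] D(1,6)
    by (subst card_Un_disjoint) (auto intro: finite_indep)
qed

text \<open>
  The constants are chosen to close the induction in \<open>every_positive_sparsely_realised\<close>.  There
  \<open>n = a + 2\<^sup>k b\<close> with \<open>log\<^sub>2 n \<le> 4 k\<close> and \<open>log\<^sub>2 b \<le> log\<^sub>2 n - k\<close>.  If \<open>C\<close> and \<open>C'\<close> are the constants for
  vertices and edges, then the graph built has at most \<open>(C + 2) log\<^sub>2 b + k + 1\<close> vertices and
  \<open>(C' + 2 C + 2) log\<^sub>2 b + k\<close> edges, so that \<open>1 + 8 k \<le> (C + 1) k\<close> and
  \<open>4 (2 C + 2) \<le> C' + 2 C + 1\<close> suffice.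
\<close>

definition sparsely_realised :: "nat \<Rightarrow> bool" where
  "sparsely_realised n \<longleftrightarrow> (\<exists>(V::nat set) E. graph_on V E \<and> card (indep V E) = n \<and>
     real (card V) \<le> 8 * log 2 (real n) \<and> real (card E) \<le> 55 * log 2 (real n))"

lemma log2_nat_mono: "1 \<le> m \<Longrightarrow> m \<le> n \<Longrightarrow> log 2 (real m) \<le> log 2 (real n)"
  by simp

text \<open>
  The Euclidean algorithm, read backwards.  In the step from \<open>(b mod a, a)\<close> to \<open>(a, b)\<close> the term
  \<open>log 2 b\<close> absorbs the cost of the quotient, because \<open>(b div a) * a \<le> b\<close>, and the potential
  \<open>log 2 a + log 2 b\<close> absorbs the one new vertex and its edge into the next marked set, because it
  grows by at least 1 (\<open>2 * (b mod a) \<le> b\<close>).  Edges are counted together with the marked set, whose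
  members cost one edge each in the following step; a quotient therefore pays for its own edges and
  twice for its vertices, whence \<open>71 = 55 + 2 * 8\<close>.
\<close>

lemma sparsely_realised_pair:
  assumes "1 \<le> a" "a \<le> b" "\<forall>q\<in>{1..b}. sparsely_realised q"
  shows "\<exists>(V::nat set) E S. graph_on V E \<and> S \<subseteq> V \<and>
     card (indep (V - S) E) = a \<and> card (indep V E) = b \<and>
     real (card V) \<le> 8 * log 2 b + (log 2 a + log 2 b) \<and>
     real (card E) + real (card S) \<le> 71 * log 2 b + (log 2 a + log 2 b)"
  using assms
proof (induction a arbitrary: b rule: less_induct)
  case (less a b)
  define q r where "q = b div a" and "r = b mod a"
  have b: "b = r + q * a" by (simp add: q_def r_def)
  have q: "1 \<le> q" "q \<le> b" using less.prems by (auto simp: q_def div_greater_zero_iff Suc_le_eq)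
  obtain W :: "nat set" and F where K: "graph_on W F" "card (indep W F) = q"
    "real (card W) \<le> 8 * log 2 q" "real (card F) \<le> 55 * log 2 q"
    using less.prems(3) q unfolding sparsely_realised_def by (meson atLeastAtMost_iff)
  show ?case
  proof (cases "r = 0")
    case True
    \<comment> \<open>Here \<open>a\<close> is the greatest common divisor of the original pair; it is realised on its own and
      multiplied by \<open>q\<close> through a disjoint union.\<close>
    obtain V :: "nat set" and E where "graph_on V E" "card (indep V E) = a"
      "real (card V) \<le> 8 * log 2 a" "real (card E) \<le> 55 * log 2 a"
      using less.prems unfolding sparsely_realised_def by (meson atLeastAtMost_iff)
    then obtain V E where G: "graph_on V E" "card (indep V E) = a" "V \<inter> W = {}"
      "real (card V) \<le> 8 * log 2 a" "real (card E) \<le> 55 * log 2 a"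
      using graph_on_fresh_copy[of V E W] graph_onD(1)[OF K(1)] by metis
    have logs: "log 2 b = log 2 q + log 2 a" "log 2 a \<ge> 0" "log 2 q \<ge> 0"
      using b True q less.prems by (auto simp: log_mult)
    have "V \<union> W - W = V" using G(3) by auto
    moreover have "indep V (E \<union> F) = indep V E"
    proof -
      have "e \<notin> F" if "e \<subseteq> V" for e
        using graph_onD(3,5)[OF K(1), of e] that G(3) by blast
      then show ?thesis by (intro indep_cong) simp
    qed
    moreover have "card (indep (V \<union> W) (E \<union> F)) = b"
      using card_indep_union[OF G(1) K(1) G(3)] G(2) K(2) b True by simp
    moreover have "real (card (V \<union> W)) \<le> 8 * log 2 b"
      "real (card (E \<union> F)) + real (card W) \<le> 63 * log 2 b"
      using logs G K card_Un_le[of V W] card_Un_le[of E F] by (simp_all add: algebra_simps)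
    ultimately show ?thesis
      using graph_on_union[OF G(1) K(1)] G(2) logs
      by (intro exI[of _ "V \<union> W"] exI[of _ "E \<union> F"] exI[of _ W]) auto
  next
    case False
    have r: "1 \<le> r" "r < a" using False less.prems by (auto simp: r_def)
    obtain V :: "nat set" and E S where G: "graph_on V E" "S \<subseteq> V" "card (indep (V - S) E) = r"
      "card (indep V E) = a" "real (card V) \<le> 8 * log 2 a + (log 2 r + log 2 a)"
      "real (card E) + real (card S) \<le> 71 * log 2 a + (log 2 r + log 2 a)"
      using less.IH[of r a] r less.prems by auto
    obtain W' F' where K': "graph_on W' F'" "V \<inter> W' = {}" "card (indep W' F') = q"
      "real (card W') \<le> 8 * log 2 q" "real (card F') \<le> 55 * log 2 q"
      using graph_on_fresh_copy[of W F V] graph_onD(1)[OF G(1)] K by (metis inf_commute)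
    obtain h where h: "h \<notin> V \<union> W'"
      using graph_onD(1)[OF G(1)] graph_onD(1)[OF K'(1)] ex_new_if_finite[of "V \<union> W'"] by auto
    note step = euclid_step[OF G(1) K'(1,2) G(2) h]
    define V' E' where "V' = insert h (V \<union> W')" and "E' = E \<union> F' \<union> (\<lambda>x. {h, x}) ` (S \<union> W')"
    have "q * a \<le> b" "2 * r \<le> b"
      using b r q(1) mult_le_mono1[OF q(1), of a] by linarith+
    have "log 2 q + log 2 a = log 2 (q * a)" using q less.prems by (simp add: log_mult)
    also have "\<dots> \<le> log 2 b" using \<open>q * a \<le> b\<close> q less.prems by (intro log2_nat_mono) auto
    finally have log1: "log 2 q + log 2 a \<le> log 2 b" .
    have "1 + log 2 r = log 2 (real (2 * r))" using r by (simp add: log_mult)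
    also have "\<dots> \<le> log 2 b" using \<open>2 * r \<le> b\<close> r by (intro log2_nat_mono) auto
    finally have log2: "1 + log 2 r \<le> log 2 b" .
    have "card (insert h W') \<le> card W' + 1"
      using card_insert_le_m1 by (simp add: card_insert_if graph_onD(1)[OF K'(1)])
    then have "real (card V') \<le> 8 * log 2 b + (log 2 a + log 2 b)"
      "real (card E') + real (card (insert h W')) \<le> 71 * log 2 b + (log 2 a + log 2 b)"
      using step(4,5) G K' log1 log2 unfolding V'_def E'_def by linarith+
    moreover have "graph_on V' E'" "card (indep (V' - insert h W') E') = a" "card (indep V' E') = b"
      using step(1-3) G K' b unfolding V'_def E'_def by auto
    moreover have "insert h W' \<subseteq> V'" by (auto simp: V'_def)
    ultimately show ?thesis by (intro exI[of _ V'] exI[of _ E'] exI[of _ "insert h W'"] conjI)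
  qed
qed

lemma sparsely_realised_small:
  assumes "1 \<le> n" "n < 4"
  shows "sparsely_realised n"
proof -
  consider "n = 1" | "n = 2" | "n = 3" using assms by linarith
  then show ?thesis
  proof cases
    case 1
    then show ?thesis unfolding sparsely_realised_def
      by (intro exI[of _ "{}"]) (simp add: graph_on_def indep_no_edges)
  next
    case 2
    then show ?thesis unfolding sparsely_realised_def
      by (intro exI[of _ "{0}"] exI[of _ "{}"]) (simp add: graph_on_def indep_no_edges card_Pow)
  next
    case 3
    have "indep {0, 1::nat} {{0, 1}} = {{}, {0}, {1}}"
      by (auto simp: indep_def)
    moreover have "log 2 3 \<ge> (1::real)" by (simp add: le_log_iff)
    then have "2 \<le> 8 * log 2 (3::real)" "1 \<le> 55 * log 2 (3::real)" by linarith+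
    ultimately show ?thesis unfolding sparsely_realised_def using 3
      by (intro exI[of _ "{0, 1}"] exI[of _ "{{0, 1}}"]) (simp add: graph_on_def)
  qed
qed

text \<open>
  The first quotient is taken to be the power of two nearest below \<open>\<surd>n\<close>, since \<open>2\<^sup>k\<close> is realised
  by \<open>k\<close> vertices without edges; the recursion is entered only for numbers of about half the length
  of \<open>n\<close>.
\<close>

theorem every_positive_sparsely_realised: "1 \<le> n \<Longrightarrow> sparsely_realised n"
proof (induction n rule: less_induct)
  case (less n)
  show ?case
  proof (cases "n < 4")
    case True
    then show ?thesis using less.prems sparsely_realised_small by blast
  next
    case False
    obtain k where k: "4 ^ k \<le> n" "n < 4 ^ Suc k"
      using ex_power_ivl1[of 4 n] less.prems by auto
    have "k \<ge> 1" using k False by (cases k) auto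
    define b a where "b = n div 2 ^ k" and "a = n mod 2 ^ k"
    have n: "n = a + 2 ^ k * b" by (simp add: a_def b_def)
    \<comment> \<open>This makes \<open>a < 2 ^ k \<le> b\<close>, the order that \<open>sparsely_realised_pair\<close> needs.\<close>
    have "2 ^ k * 2 ^ k \<le> n" using k(1) by (simp flip: power_mult_distrib)
    then have b: "2 ^ k \<le> b" unfolding b_def by (simp add: less_eq_div_iff_mult_less_eq)
    have "a < 2 ^ k" by (simp add: a_def)
    have "(1::nat) < 2 ^ k" using \<open>k \<ge> 1\<close> by (intro one_less_power) auto
    then have "b < n" unfolding b_def using less.prems by (intro div_less_dividend) auto
    have IH: "\<forall>q\<in>{1..b}. sparsely_realised q"
      using less.IH \<open>b < n\<close> by simp
    have "1 \<le> b" using b by (meson le_trans one_le_numeral one_le_power)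
    have log0: "log 2 b \<ge> 0" using \<open>1 \<le> b\<close> by simp
    have "k + log 2 b = log 2 (real (2 ^ k * b))"
      using \<open>1 \<le> b\<close> by (simp add: log_mult log_nat_power)
    also have "\<dots> \<le> log 2 n" using n \<open>1 \<le> b\<close> by (intro log2_nat_mono) auto
    finally have log1: "k + log 2 b \<le> log 2 n" .
    have "log 2 n \<le> log 2 (real (4 ^ Suc k))"
      using k(2) less.prems by (intro log2_nat_mono) auto
    also have "real (4 ^ Suc k) = (2::real) ^ (2 * Suc k)" by (simp add: power_mult)
    also have "log 2 (2 ^ (2 * Suc k)) = real (2 * Suc k)" by (simp add: log_nat_power del: power_Suc)
    also have "\<dots> \<le> 4 * k" using \<open>k \<ge> 1\<close> by simp
    finally have log2: "log 2 n \<le> 4 * k" by simp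
    define W where "W = {..<k}"
    have W: "graph_on W {}" "card W = k" "card (indep W {}) = 2 ^ k"
      by (simp_all add: W_def graph_on_def indep_no_edges card_Pow)
    show ?thesis
    proof (cases "a = 0")
      case True
      obtain V :: "nat set" and E where "graph_on V E" "card (indep V E) = b"
        "real (card V) \<le> 8 * log 2 b" "real (card E) \<le> 55 * log 2 b"
        using IH \<open>1 \<le> b\<close> unfolding sparsely_realised_def by (meson atLeastAtMost_iff order_refl)
      then obtain V E where G: "graph_on V E" "card (indep V E) = b" "V \<inter> W = {}"
        "real (card V) \<le> 8 * log 2 b" "real (card E) \<le> 55 * log 2 b"
        using graph_on_fresh_copy[of V E W] graph_onD(1)[OF W(1)] by metis
      have "card (indep (V \<union> W) E) = n"
        using card_indep_union[OF G(1) W(1) G(3)] n True G(2) W(3) by simp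
      moreover have "real (card (V \<union> W)) \<le> 8 * log 2 n"
        using log1 G(4) W(2) card_Un_le[of V W] by linarith
      moreover have "graph_on (V \<union> W) E" using graph_on_union[OF G(1) W(1)] by simp
      moreover have "real (card E) \<le> 55 * log 2 n" using G(5) log1 by linarith
      ultimately show ?thesis unfolding sparsely_realised_def by blast
    next
      case False
      have ab: "1 \<le> a" "a \<le> b" using False \<open>a < 2 ^ k\<close> b by auto
      obtain V :: "nat set" and E S where G: "graph_on V E" "S \<subseteq> V" "card (indep (V - S) E) = a"
        "card (indep V E) = b" "real (card V) \<le> 8 * log 2 b + (log 2 a + log 2 b)"
        "real (card E) + real (card S) \<le> 71 * log 2 b + (log 2 a + log 2 b)"
        using sparsely_realised_pair[OF ab IH] by (elim exE conjE) (rule that; assumption)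
      have logab: "log 2 a \<le> log 2 b" using ab by simp
      obtain W' F' where K: "graph_on W' F'" "V \<inter> W' = {}" "card (indep W' F') = 2 ^ k"
        "card W' = k" "card F' = 0"
        using graph_on_fresh_copy[OF W(1), of V] graph_onD(1)[OF G(1)] W
        by (metis inf_commute card.empty)
      obtain h where h: "h \<notin> V \<union> W'"
        using graph_onD(1)[OF G(1)] graph_onD(1)[OF K(1)] ex_new_if_finite[of "V \<union> W'"] by auto
      note step = euclid_step[OF G(1) K(1,2) G(2) h]
      define V' E' where "V' = insert h (V \<union> W')" and "E' = E \<union> F' \<union> (\<lambda>x. {h, x}) ` (S \<union> W')"
      have "real (card V') \<le> 8 * log 2 n" "real (card E') \<le> 55 * log 2 n"
        using step(4,5) G(5,6) K(4,5) logab log0 log1 log2 \<open>k \<ge> 1\<close> unfolding V'_def E'_def by linarith+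
      moreover have "graph_on V' E'" "card (indep V' E') = n"
        using step(1,3) G(3,4) K(3) n unfolding V'_def E'_def by auto
      ultimately show ?thesis unfolding sparsely_realised_def by blast
    qed
  qed
qed

section \<open>Values realised at large and at small average degree\<close>

text \<open>
  A graph with \<open>n\<close> independent sets has at least \<open>log 2 n\<close> vertices, so \<open>55 * log 2 n\<close> edges mean an
  average degree of at most \<open>2 * 55\<close>.
\<close>

lemma all_positive_in_counts:
  assumes "1 \<le> n" "d \<ge> 110"
  shows "n \<in> independent_set_counts d"
proof -
  obtain V :: "nat set" and E where G: "graph_on V E" "card (indep V E) = n"
    "real (card E) \<le> 55 * log 2 n"
    using every_positive_sparsely_realised[OF assms(1)] unfolding sparsely_realised_def by blast
  have "real n \<le> 2 ^ card V"
    using card_indep_le[OF graph_onD(1)[OF G(1)], of E] G(2)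
    by (metis of_nat_le_iff of_nat_numeral of_nat_power)
  then have "log 2 n \<le> card V"
    using assms(1) by (simp add: log_le_iff powr_realpow)
  then have "2 * real (card E) \<le> 110 * real (card V)" using G(3) by linarith
  also have "\<dots> \<le> d * real (card V)" using assms(2) by (intro mult_right_mono) auto
  finally have "2 * real (card E) \<le> d * real (card V)" .
  then show ?thesis using card_indep_in_counts[OF G(1)] assms(2) G(2) by auto
qed

text \<open>
  The number \<open>T * k\<close> of isolated vertices depends on \<open>k\<close> only, so that distinct \<open>n\<close> give distinct
  values.
\<close>

lemma padded_in_counts:
  assumes "1 \<le> n" "n \<le> 2 ^ k" "d > 0" "real T \<ge> 110 / d"
  shows "n * 2 ^ (T * k) \<in> independent_set_counts d"
proof -
  obtain V :: "nat set" and E where G: "graph_on V E" "card (indep V E) = n"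
    "real (card E) \<le> 55 * log 2 n"
    using every_positive_sparsely_realised[OF assms(1)] unfolding sparsely_realised_def by blast
  define W where "W = {..<T * k}"
  have W: "graph_on W {}" "card W = T * k" "card (indep W {}) = 2 ^ (T * k)"
    by (simp_all add: W_def graph_on_def indep_no_edges card_Pow)
  obtain W' F' where K: "graph_on W' F'" "V \<inter> W' = {}" "card (indep W' F') = 2 ^ (T * k)"
    "card W' = T * k" "card F' = 0"
    using graph_on_fresh_copy[OF W(1), of V] graph_onD(1)[OF G(1)] W by (metis inf_commute card.empty)
  have F': "F' = {}" using K(5) graph_onD(2)[OF K(1)] by simp
  have "real n \<le> 2 ^ k" using assms(2) by (metis of_nat_le_iff of_nat_numeral of_nat_power)
  then have "log 2 n \<le> k" using assms(1) by (simp add: log_le_iff powr_realpow)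
  then have "2 * real (card E) \<le> 110 * real k" using G(3) by linarith
  also have "\<dots> \<le> (d * real T) * real k"
    using assms(3,4) by (intro mult_right_mono) (auto simp: field_simps)
  also have "\<dots> \<le> d * real (card (V \<union> W'))"
    using K(4) assms(3) card_Un_disjoint[OF graph_onD(1)[OF G(1)] graph_onD(1)[OF K(1)] K(2)]
    by (simp add: algebra_simps)
  finally have "2 * real (card E) \<le> d * real (card (V \<union> W'))" .
  moreover have "graph_on (V \<union> W') E" using graph_on_union[OF G(1) K(1)] F' by simp
  ultimately have "card (indep (V \<union> W') E) \<in> independent_set_counts d"
    using assms(3) by (intro card_indep_in_counts) auto
  moreover have "card (indep (V \<union> W') E) = n * 2 ^ (T * k)"
    using card_indep_union[OF G(1) K(1,2)] F' G(2) K(3) by simp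
  ultimately show ?thesis by simp
qed

lemma counts_lower_bound:
  assumes "d > 0" "real T \<ge> 110 / d" "1 \<le> N"
  shows "real N powr (1 / (real T + 1)) \<le> 2 * real (card (independent_set_counts d \<inter> {1..N}))"
proof -
  define k where "k = nat \<lfloor>log 2 N / (T + 1)\<rfloor>"
  have logN: "log 2 N \<ge> 0" using assms(3) by simp
  have k: "real k \<le> log 2 N / (T + 1)" "log 2 N / (T + 1) < k + 1"
    unfolding k_def using logN by (simp, linarith)
  have "real ((T + 1) * k) \<le> log 2 N" using k(1) by (simp add: field_simps)
  then have "2 powr real ((T + 1) * k) \<le> real N" using assms(3) by (simp add: le_log_iff)
  then have "real (2 ^ ((T + 1) * k)) \<le> real N" by (simp only: powr_realpow) simp
  then have pow: "2 ^ ((T + 1) * k) \<le> N" by (simp only: of_nat_le_iff)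
  have "(\<lambda>n. n * 2 ^ (T * k)) ` {1..2 ^ k::nat} \<subseteq> independent_set_counts d \<inter> {1..N}"
  proof
    fix m :: nat assume "m \<in> (\<lambda>n. n * 2 ^ (T * k)) ` {1..2 ^ k}"
    then obtain n :: nat where n: "1 \<le> n" "n \<le> 2 ^ k" and m: "m = n * 2 ^ (T * k)" by auto
    have "n * 2 ^ (T * k) \<le> 2 ^ k * 2 ^ (T * k)" using n by simp
    also have "\<dots> = 2 ^ ((T + 1) * k)" by (simp add: power_add algebra_simps)
    also have "\<dots> \<le> N" by (rule pow)
    finally have "m \<le> N" by (simp add: m)
    moreover have "m \<in> independent_set_counts d"
      unfolding m using padded_in_counts[OF n assms(1,2)] .
    moreover have "1 \<le> m" using n by (simp add: m Suc_le_eq)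
    ultimately show "m \<in> independent_set_counts d \<inter> {1..N}" by simp
  qed
  then have "card ((\<lambda>n. n * 2 ^ (T * k)) ` {1..2 ^ k::nat}) \<le> card (independent_set_counts d \<inter> {1..N})"
    by (intro card_mono) auto
  also have "card ((\<lambda>n. n * 2 ^ (T * k)) ` {1..2 ^ k::nat}) = 2 ^ k"
    by (subst card_image) (auto simp: inj_on_def)
  finally have card: "2 ^ k \<le> card (independent_set_counts d \<inter> {1..N})" .
  have "real N powr (1 / (real T + 1)) = 2 powr (log 2 N / (T + 1))"
    using assms(3) by (simp add: powr_def log_def)
  also have "\<dots> \<le> 2 powr (k + 1)" using k(2) by simp
  also have "\<dots> = 2 * real (2 ^ k)" by (simp add: powr_add powr_realpow)
  also have "\<dots> \<le> 2 * real (card (independent_set_counts d \<inter> {1..N}))"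
    using card by (intro mult_left_mono) (simp_all only: of_nat_le_iff zero_le_numeral)
  finally show ?thesis .
qed

section \<open>Few numbers are realised when the average degree is below two\<close>

text \<open>
  This replaces the existence of a connected component and of its spanning tree.  A nonempty \<open>C\<close> with
  at least \<open>|C| - 1\<close> inner edges can be enlarged by the far end of any edge that leaves it, so a
  maximal such \<open>C\<close> has no leaving edge.
\<close>

lemma exists_detached_part:
  assumes "finite V" "V \<noteq> {}" "\<forall>e\<in>E. card e = 2"
  shows "\<exists>C\<subseteq>V. C \<noteq> {} \<and> card C \<le> card {e\<in>E. e \<subseteq> C} + 1 \<and>
    (\<forall>e\<in>E. e \<subseteq> V \<longrightarrow> e \<subseteq> C \<or> e \<subseteq> V - C)"
proof -
  define P where "P = {C. C \<subseteq> V \<and> C \<noteq> {} \<and> card C \<le> card {e\<in>E. e \<subseteq> C} + 1}"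
  obtain v where "v \<in> V" using assms(2) by blast
  then have "{v} \<in> P" by (auto simp: P_def)
  moreover have "finite P" using assms(1) by (rule_tac finite_subset[of _ "Pow V"]) (auto simp: P_def)
  ultimately obtain C where C: "C \<in> P" and max: "\<And>D. D \<in> P \<Longrightarrow> C \<subseteq> D \<Longrightarrow> C = D"
    using finite_has_maximal[of P] by blast
  have "e \<subseteq> C \<or> e \<subseteq> V - C" if e: "e \<in> E" "e \<subseteq> V" for e
  proof (rule ccontr)
    assume "\<not> ?thesis"
    moreover obtain x y where "e = {x, y}" using assms(3) e(1) by (metis card_2_iff)
    ultimately obtain x y where xy: "e = {x, y}" "x \<in> C" "y \<notin> C" using e(2) by (auto simp: insert_commute)
    have finC: "finite C" using C assms(1) finite_subset by (auto simp: P_def)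
    have "insert e {e\<in>E. e \<subseteq> C} \<subseteq> {e\<in>E. e \<subseteq> insert y C}" using e(1) xy by auto
    moreover have "finite {e\<in>E. e \<subseteq> insert y C}" by (rule finite_subset[of _ "Pow (insert y C)"]) (use finC in auto)
    ultimately have "card (insert e {e\<in>E. e \<subseteq> C}) \<le> card {e\<in>E. e \<subseteq> insert y C}" by (rule card_mono[rotated])
    moreover have "card (insert e {e\<in>E. e \<subseteq> C}) = Suc (card {e\<in>E. e \<subseteq> C})"
      using xy finite_subset[of "{e\<in>E. e \<subseteq> C}" "Pow C"] finC by (subst card_insert_disjoint) auto
    ultimately have "insert y C \<in> P" using C xy e finC by (auto simp: P_def)
    then show False using max[of "insert y C"] xy(3) by auto
  qed
  then show ?thesis using C unfolding P_def by blast
qed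

text \<open>
  Detach one part \<open>C\<close> at a time.  If \<open>|C| \<le> s\<close>, its count lies in \<open>{2..2 ^ s}\<close> and goes into the smooth
  factor; otherwise it goes into \<open>B\<close>.  Removing \<open>C\<close> lowers the exponent
  \<open>v (1 - 1 / (s + 1)) - e\<close> by at most \<open>1 - |C| / (s + 1)\<close>.  This is at most 1, which is paid for by
  the factor 2 of a small part, and it is at most 0 for a large part.  The exponent is a lower bound
  for the number of small parts: there are at least \<open>v - e\<close> parts, of which at most \<open>v / (s + 1)\<close> are
  large.
\<close>

lemma count_has_large_smooth_factor:
  fixes s :: nat
  assumes "finite V" "\<forall>e\<in>E. card e = 2"
  shows "\<exists>f B. card (indep V E) = (\<Prod>j\<in>{2..2 ^ s}. j ^ f j) * B \<and>
    2 powr (real (card V) * (1 - 1 / (s + 1)) - real (card {e\<in>E. e \<subseteq> V}))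
      \<le> real (\<Prod>j\<in>{2..2 ^ s}. j ^ f j)"
  using assms(1)
proof (induction V rule: finite_psubset_induct)
  case (psubset V)
  show ?case
  proof (cases "V = {}")
    case True
    then have "{e\<in>E. e \<subseteq> V} = {}" using assms(2) by force
    then have "card {e\<in>E. e \<subseteq> V} = 0" by (simp only: card.empty)
    then show ?thesis unfolding \<open>card {e\<in>E. e \<subseteq> V} = 0\<close>
      by (intro exI[of _ "\<lambda>_. 0"] exI[of _ "card (indep V E)"]) (simp add: True)
  next
    case False
    obtain C where C: "C \<subseteq> V" "C \<noteq> {}" "card C \<le> card {e\<in>E. e \<subseteq> C} + 1"
      and split: "\<forall>e\<in>E. e \<subseteq> V \<longrightarrow> e \<subseteq> C \<or> e \<subseteq> V - C"
      using exists_detached_part[OF psubset.hyps False assms(2)]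
      by (elim exE conjE) (rule that)
    have less: "V - C \<subset> V" using C by blast
    obtain f B where fB: "card (indep (V - C) E) = (\<Prod>j\<in>{2..2 ^ s}. j ^ f j) * B"
      "2 powr (real (card (V - C)) * (1 - 1 / (s + 1)) - real (card {e\<in>E. e \<subseteq> V - C}))
      \<le> real (\<Prod>j\<in>{2..2 ^ s}. j ^ f j)"
      using psubset.IH[OF less] by (elim exE conjE) (rule that)
    define A where "A = (\<Prod>j\<in>{2..2 ^ s}. j ^ f j)"
    define x where "x = real (card (V - C)) * (1 - 1 / (s + 1)) - real (card {e\<in>E. e \<subseteq> V - C})"
    define y where "y = real (card V) * (1 - 1 / (s + 1)) - real (card {e\<in>E. e \<subseteq> V})"
    define c where "c = card (indep C E)"
    have finC: "finite C" using C psubset.hyps finite_subset by blast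
    have "C \<union> (V - C) = V" using C by auto
    then have prod: "card (indep V E) = c * card (indep (V - C) E)"
      using card_indep_disjoint[of C "V - C" E] split by (simp add: c_def)
    have cardV: "card V = card C + card (V - C)"
      using C psubset.hyps finC by (simp add: card_Diff_subset card_mono)
    have "{e\<in>E. e \<subseteq> V} = {e\<in>E. e \<subseteq> C} \<union> {e\<in>E. e \<subseteq> V - C}" using split C by auto
    moreover have "{e\<in>E. e \<subseteq> C} \<inter> {e\<in>E. e \<subseteq> V - C} = {}"
    proof -
      have "e = {}" if "e \<subseteq> C" "e \<subseteq> V - C" for e using that by blast
      moreover have "{} \<notin> E" using assms(2) by force
      ultimately show ?thesis by blast
    qed
    moreover have "finite {e\<in>E. e \<subseteq> C}" "finite {e\<in>E. e \<subseteq> V - C}"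
      using finC psubset.hyps by (auto intro: finite_subset[of _ "Pow C"] finite_subset[of _ "Pow (V - C)"])
    ultimately have cardE: "card {e\<in>E. e \<subseteq> V} = card {e\<in>E. e \<subseteq> C} + card {e\<in>E. e \<subseteq> V - C}"
      by (simp add: card_Un_disjoint)
    have "y = x + real (card C) - real (card C) / (s + 1) - real (card {e\<in>E. e \<subseteq> C})"
      by (simp add: x_def y_def cardV cardE algebra_simps)
    then have yx: "y \<le> x + 1 - real (card C) / (s + 1)" using C(3) by linarith
    show ?thesis
    proof (cases "card C \<le> s")
      case True
      obtain v where "v \<in> C" using C by blast
      have "{{}, {v}} \<subseteq> indep C E" using \<open>v \<in> C\<close> assms(2) by (force simp: indep_def subset_singleton_iff)
      from card_mono[OF finite_indep[OF finC] this] have c2: "2 \<le> c" by (simp add: c_def)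
      have "c \<le> 2 ^ card C" using card_indep_le[OF finC] by (simp add: c_def)
      also have "\<dots> \<le> 2 ^ s" using True by simp
      finally have cs: "c \<in> {2..2 ^ s}" using c2 by simp
      define g where "g = f(c := Suc (f c))"
      have A: "(\<Prod>j\<in>{2..2 ^ s}. j ^ g j) = c * A"
      proof -
        have "(\<Prod>j\<in>{2..2 ^ s}. j ^ g j) = c ^ g c * (\<Prod>j\<in>{2..2 ^ s} - {c}. j ^ g j)"
          using cs by (intro prod.remove) auto
        also have "(\<Prod>j\<in>{2..2 ^ s} - {c}. j ^ g j) = (\<Prod>j\<in>{2..2 ^ s} - {c}. j ^ f j)"
          by (intro prod.cong) (auto simp: g_def)
        also have "c ^ g c * \<dots> = c * (c ^ f c * \<dots>)" by (simp add: g_def)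
        also have "c ^ f c * (\<Prod>j\<in>{2..2 ^ s} - {c}. j ^ f j) = A"
          unfolding A_def using cs by (intro prod.remove[symmetric]) auto
        finally show ?thesis .
      qed
      have "0 \<le> real (card C) / (s + 1)" by simp
      then have "y \<le> x + 1" using yx by linarith
      then have "2 powr y \<le> 2 powr (x + 1)" by simp
      also have "\<dots> = 2 * 2 powr x" by (simp add: powr_add)
      also have "\<dots> \<le> real c * real A" using fB(2) c2 unfolding x_def A_def by (intro mult_mono) auto
      finally have "2 powr y \<le> real (\<Prod>j\<in>{2..2 ^ s}. j ^ g j)" unfolding A by simp
      moreover have "card (indep V E) = (\<Prod>j\<in>{2..2 ^ s}. j ^ g j) * B"
        unfolding A prod fB(1) A_def by simp
      ultimately show ?thesis unfolding y_def by blast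
    next
      case False
      then have "real (card C) / (s + 1) \<ge> 1" by (simp add: field_simps)
      then have "y \<le> x" using yx by linarith
      then have "2 powr y \<le> 2 powr x" by simp
      also have "\<dots> \<le> real A" using fB(2) unfolding x_def A_def .
      finally have "2 powr y \<le> real A" .
      moreover have "card (indep V E) = A * (c * B)" unfolding prod fB(1) A_def by simp
      ultimately show ?thesis unfolding y_def A_def by blast
    qed
  qed
qed

text \<open>
  A count \<open>n \<le> N\<close> is determined by the exponents of its smooth factor, each at most \<open>log 2 N\<close>, and by
  the cofactor.  With \<open>\<delta> = (1 - d / 2) / 2\<close> the choice of \<open>s\<close> leaves an exponent of at least
  \<open>\<delta> v\<close> in the bound for the smooth factor: half of \<open>v - e \<ge> 2 \<delta> v\<close> is given up for the large parts.
\<close>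

lemma counts_upper_bound:
  assumes d: "0 < d" "d < 2" and s: "1 / (real s + 1) \<le> (1 - d / 2) / 2" and N: "1 \<le> N"
  shows "real (card (independent_set_counts d \<inter> {1..N}))
    \<le> (log 2 (real N) + 1) ^ (2 ^ s) * real N powr (1 - (1 - d / 2) / 2)"
proof -
  define \<delta> where "\<delta> = (1 - d / 2) / 2"
  define J :: "nat set" where "J = {2..2 ^ s}"
  define k where "k = nat \<lfloor>log 2 N\<rfloor>"
  define M where "M = nat \<lfloor>real N powr (1 - \<delta>)\<rfloor>"
  have \<delta>: "0 < \<delta>" "\<delta> < 1" using d by (auto simp: \<delta>_def)
  have logN: "log 2 N \<ge> 0" using N by simp
  have "independent_set_counts d \<inter> {1..N} \<subseteq>
    (\<lambda>(f, B). (\<Prod>j\<in>J. j ^ f j) * B) ` ((J \<rightarrow>\<^sub>E {..k}) \<times> {1..M})"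
  proof
    fix n assume n: "n \<in> independent_set_counts d \<inter> {1..N}"
    then obtain G :: "nat pair_pre_digraph"
      where G: "pair_graph G" "average_degree G \<le> d" "n = num_independent_sets G"
      by (auto simp: independent_set_counts_def)
    define V E where "V = pverts G" and "E = edges G"
    have g: "graph_on V E" and nV: "n = card (indep V E)"
      using graph_on_of_pair_graph[OF G(1)] G(3) by (auto simp: V_def E_def)
    note D = graph_onD[OF g]
    obtain f B where fB: "n = (\<Prod>j\<in>J. j ^ f j) * B"
      "2 powr (real (card V) * (1 - 1 / (s + 1)) - real (card {e\<in>E. e \<subseteq> V})) \<le> real (\<Prod>j\<in>J. j ^ f j)"
      using count_has_large_smooth_factor[OF D(1), of E s] D(4) nV unfolding J_def by blast
    define A where "A = (\<Prod>j\<in>J. j ^ f j)"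
    have n1: "1 \<le> n" "n \<le> N" using n by auto
    have AB: "n = A * B" using fB(1) A_def by simp
    have AB1: "A \<ge> 1" "B \<ge> 1" using AB n1(1) by (auto simp: Suc_le_eq)
    have "A \<le> N" using AB AB1 n1 by (metis dual_order.trans mult.right_neutral mult_le_mono2)
    have E: "real (card E) \<le> d / 2 * real (card V)"
    proof (cases "V = {}")
      case True
      then have "E = {}" using D(3,5) by blast
      then show ?thesis using d by simp
    next
      case False
      then show ?thesis using G(2) D(1)
        by (auto simp: average_degree_def V_def E_def field_simps card_gt_0_iff)
    qed
    have all: "{e\<in>E. e \<subseteq> V} = E" using D(3) by auto
    have "real n \<le> 2 ^ card V"
      using card_indep_le[OF D(1), of E] nV by (metis of_nat_le_iff of_nat_numeral of_nat_power)
    then have "real n powr \<delta> \<le> (2 ^ card V) powr \<delta>" using \<delta> by (intro powr_mono2) auto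
    also have "\<dots> = 2 powr (real (card V) * \<delta>)" by (simp add: powr_powr flip: powr_realpow)
    also have "\<dots> \<le> 2 powr (real (card V) * (1 - 1 / (s + 1)) - real (card {e\<in>E. e \<subseteq> V}))"
    proof -
      have "real (card V) * (1 / (s + 1)) \<le> real (card V) * \<delta>"
        using s by (intro mult_left_mono) (simp_all add: \<delta>_def add.commute)
      moreover have "real (card V) * (1 - d / 2) = real (card V) * \<delta> + real (card V) * \<delta>"
        by (simp add: \<delta>_def field_simps)
      ultimately show ?thesis using E all by (simp add: algebra_simps)
    qed
    also have "\<dots> \<le> real A" using fB(2) by (simp add: A_def)
    finally have nA: "real n powr \<delta> \<le> real A" .
    have "real B * real n powr \<delta> \<le> real B * real A" using nA by (intro mult_left_mono) auto
    also have "\<dots> = real n powr 1" using AB by simp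
    finally have "real B \<le> real n powr (1 - \<delta>)"
      using n1 by (simp add: powr_diff field_simps)
    also have "\<dots> \<le> real N powr (1 - \<delta>)" using n1 \<delta> by (intro powr_mono2) auto
    finally have "B \<le> M" unfolding M_def by linarith
    moreover have "f j \<le> k" if j: "j \<in> J" for j
    proof -
      have "(2::nat) ^ f j \<le> j ^ f j" using j by (intro power_mono) (auto simp: J_def)
      also have "\<dots> dvd A" unfolding A_def using j by (intro dvd_prodI) (auto simp: J_def)
      then have "j ^ f j \<le> A" using AB1 by (intro dvd_imp_le) auto
      also have "\<dots> \<le> N" by fact
      finally have "(2::real) ^ f j \<le> real N" by (metis of_nat_le_iff of_nat_numeral of_nat_power)
      then have "real (f j) \<le> log 2 N" using N by (simp add: le_log_iff powr_realpow)
      then show ?thesis unfolding k_def by linarith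
    qed
    moreover have "A = (\<Prod>j\<in>J. j ^ restrict f J j)" unfolding A_def by (intro prod.cong) auto
    ultimately show "n \<in> (\<lambda>(f, B). (\<Prod>j\<in>J. j ^ f j) * B) ` ((J \<rightarrow>\<^sub>E {..k}) \<times> {1..M})"
      using AB AB1 by (intro image_eqI[of _ _ "(restrict f J, B)"]) auto
  qed
  then have "card (independent_set_counts d \<inter> {1..N}) \<le>
    card ((\<lambda>(f, B). (\<Prod>j\<in>J. j ^ f j) * B) ` ((J \<rightarrow>\<^sub>E {..k}) \<times> {1..M}))"
    by (intro card_mono finite_imageI finite_SigmaI finite_PiE) (auto simp: J_def)
  also have "\<dots> \<le> card ((J \<rightarrow>\<^sub>E {..k}) \<times> {1..M})"
    by (intro card_image_le finite_SigmaI finite_PiE) (auto simp: J_def)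
  also have "\<dots> = (k + 1) ^ card J * M"
    by (simp add: card_cartesian_product card_PiE J_def)
  also have "\<dots> \<le> (k + 1) ^ (2 ^ s) * M"
    by (intro mult_right_mono power_increasing) (auto simp: J_def)
  finally have "real (card (independent_set_counts d \<inter> {1..N})) \<le> real (k + 1) ^ (2 ^ s) * real M"
    by (metis of_nat_le_iff of_nat_mult of_nat_power)
  also have "\<dots> \<le> (log 2 (real N) + 1) ^ (2 ^ s) * real N powr (1 - \<delta>)"
    unfolding k_def M_def using logN by (intro mult_mono power_mono) auto
  finally show ?thesis by (simp add: \<delta>_def)
qed

theorem theorem1p7:
  shows "\<exists>D::real. D > 0 \<and>
    (\<forall>d::real. 0 < d \<and> d < 2 \<longrightarrow>
       (\<exists>c1 c2::real. 0 < c1 \<and> c1 \<le> c2 \<and> c2 < 1 \<and>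
          (\<lambda>N::nat. real N powr c1) \<in> O(\<lambda>N. real (card (independent_set_counts d \<inter> {1..N}))) \<and>
          (\<lambda>N::nat. real (card (independent_set_counts d \<inter> {1..N}))) \<in> O(\<lambda>N. real N powr c2))) \<and>
    (\<forall>d::real. d \<ge> D \<longrightarrow> (\<forall>n::nat. n \<ge> 1 \<longrightarrow> n \<in> independent_set_counts d))"
proof (rule exI[of _ 110], intro conjI allI impI)
  fix d :: real assume "0 < d \<and> d < 2"
  then have d: "0 < d" "d < 2" by auto
  define \<delta> where "\<delta> = (1 - d / 2) / 2"
  have \<delta>: "0 < \<delta>" "\<delta> < 1 / 2" using d by (auto simp: \<delta>_def)
  obtain T :: nat where T: "110 / d \<le> real T" using real_arch_simple by blast
  have "1 \<le> 110 / d" using d by simp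
  then have T1: "1 \<le> real T" using T by linarith
  obtain s :: nat where s: "1 / \<delta> \<le> real s" using real_arch_simple by blast
  have s': "1 / (real s + 1) \<le> \<delta>" using s \<delta> by (simp add: field_simps)
  define c1 c2 where "c1 = 1 / (real T + 1)" and "c2 = 1 - \<delta> / 2"
  \<comment> \<open>The exponent \<open>1 - \<delta> / 2\<close> lies above \<open>1 - \<delta>\<close> to absorb the power of the logarithm.\<close>
  have "0 < c1" "c2 < 1" using \<delta> by (auto simp: c1_def c2_def)
  have "c1 \<le> 1 / 2" using T1 by (simp add: c1_def field_simps)
  then have "c1 \<le> c2" using \<delta> by (simp add: c2_def)
  have lower: "(\<lambda>N::nat. real N powr c1) \<in> O(\<lambda>N. real (card (independent_set_counts d \<inter> {1..N})))"
    using counts_lower_bound[OF d(1) T] unfolding c1_def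
    by (intro bigoI[of _ 2] eventually_mono[OF eventually_ge_at_top[of 1]]) auto
  have "(\<lambda>N::nat. real (card (independent_set_counts d \<inter> {1..N})))
      \<in> O(\<lambda>N. (log 2 (real N) + 1) ^ (2 ^ s) * real N powr (1 - \<delta>))"
    using counts_upper_bound[OF d s'[unfolded \<delta>_def]]
    by (intro bigoI[of _ 1] eventually_mono[OF eventually_ge_at_top[of 1]]) (fastforce simp: \<delta>_def)
  also have "(\<lambda>N::nat. (log 2 (real N) + 1) ^ (2 ^ s) * real N powr (1 - \<delta>)) \<in> O(\<lambda>N. real N powr c2)"
    unfolding c2_def using \<delta> by real_asymp
  finally have upper: "(\<lambda>N::nat. real (card (independent_set_counts d \<inter> {1..N}))) \<in> O(\<lambda>N. real N powr c2)" .
  show "\<exists>c1 c2::real. 0 < c1 \<and> c1 \<le> c2 \<and> c2 < 1 \<and>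
          (\<lambda>N::nat. real N powr c1) \<in> O(\<lambda>N. real (card (independent_set_counts d \<inter> {1..N}))) \<and>
          (\<lambda>N::nat. real (card (independent_set_counts d \<inter> {1..N}))) \<in> O(\<lambda>N. real N powr c2)"
    using \<open>0 < c1\<close> \<open>c1 \<le> c2\<close> \<open>c2 < 1\<close> lower upper by blast
next
  fix d :: real and n :: nat assume "110 \<le> d" "1 \<le> n"
  then show "n \<in> independent_set_counts d" using all_positive_in_counts by blast
qed simp

end
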